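(* Every labelled transition matrix of a DOAG is a variation matrix. Furthermore, let $A = (a_{i,j})_{1 \le i,j \le n}$ be a variation matrix and for each $j \in \{1,\dots,n\}$ let $b_j$ be the largest $i \le n$ such that $a_{i,j} > 0$ if such an index exists, and $b_j = 0$ otherwise. Then $A$ is the labelled transition matrix of some DOAG if and only if both of the following hold: (i) the sequence $j \mapsto b_j$ is weakly increasing; (ii) whenever $b_j = b_{j+1} \geq 1$, we have $a_{b_j,j} < a_{b_j,j+1}$.
   Context: A directed ordered acyclic graph (DOAG) is a tuple $(V, E, (\prec_v)_{v \in V \cup \{\emptyset\}})$ where $V$ is a finite set of vertices, $E \subseteq V \times V$ is a set of edges such that $(V,E)$ is acyclic, for each $v \in V$, $\prec_v$ is a total order on the outgoing edges of $v$, and $\prec_\emptyset$ is a total order on the sources (vertices with no incoming edge). Two DOAGs are equal if there is a bijection of vertex sets preserving edges and all orders. Decomposition labelling: given a DOAG with $n$ vertices, repeatedly remove the smallest source (for the current source order) together with its outgoing edges; the sources newly uncovered by this removal are declared larger than all remaining previous sources, and are ordered among themselves in the order in which they appear as children of the removed vertex (w.r.t. its out-edge order). Labelling the vertices $1,\dots,n$ in the order they are removed gives a canonical labelling. The labelled transition matrix of the DOAG is $(a_{i,j})_{1\le i,j\le n}$ where $a_{i,j} = k > 0$ if there is an edge from vertex $i$ to vertex $j$ and it is the $k$-th outgoing edge of $i$, and $a_{i,j} = 0$ otherwise. A variation (of size $\ell$) is a sequence of $\ell$ non-negative integers in which each positive integer appears at most once and, if $0<i<j$ and $j$ appears, then $i$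 appears. A variation matrix of size $n$ is an integer matrix $(a_{i,j})_{1\le i,j\le n}$ that is strictly upper triangular and such that for each $1 \le i \le n-1$ the sub-row $(a_{i,j})_{i<j\le n}$ is a variation. *)

theory Defs
  imports "Jordan_Normal_Form.Matrix"
begin

section \<open>Directed ordered acyclic graphs\<close>

text \<open>
  The family of orders indexed by the vertices and the extra symbol for the empty set is split
  into the fields \<open>out_order\<close> (indexed by vertices) and \<open>src_order\<close>.  All orders are strict, and
  \<open>out_order G v\<close> is a relation on the outgoing edges of \<open>v\<close>, not on its children.
\<close>

record 'v doag =
  verts :: "'v set"
  edges :: "('v \<times> 'v) set"
  out_order :: "'v \<Rightarrow> ('v \<times> 'v) rel"
  src_order :: "'v rel"

definition strict_total_order_on :: "'a set \<Rightarrow> 'a rel \<Rightarrow> bool" where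
  "strict_total_order_on S r \<longleftrightarrow> r \<subseteq> S \<times> S \<and> strict_linear_order_on S r"

definition out_edges :: "'v doag \<Rightarrow> 'v \<Rightarrow> ('v \<times> 'v) set" where
  "out_edges G v = {e \<in> edges G. fst e = v}"

definition sources :: "'v set \<Rightarrow> ('v \<times> 'v) set \<Rightarrow> 'v set" where
  "sources V E = {v \<in> V. \<forall>u. (u, v) \<notin> E}"

definition is_doag :: "'v doag \<Rightarrow> bool" where
  "is_doag G \<longleftrightarrow>
     finite (verts G) \<and>
     edges G \<subseteq> verts G \<times> verts G \<and>
     acyclic (edges G) \<and>
     (\<forall>v \<in> verts G. strict_total_order_on (out_edges G v) (out_order G v)) \<and>
     strict_total_order_on (sources (verts G) (edges G)) (src_order G)"


section \<open>Decomposition labelling\<close>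

definition smallest_source :: "'v doag \<Rightarrow> 'v" where
  "smallest_source G =
     (THE s. s \<in> sources (verts G) (edges G) \<and>
             (\<forall>t \<in> sources (verts G) (edges G). t \<noteq> s \<longrightarrow> (s, t) \<in> src_order G))"

text \<open>
  The three parts of the new source order are: the old order on the remaining old sources, every
  old source below every newly uncovered one, and the newly uncovered ones compared as
  children of \<open>s\<close>.  The field \<open>out_order\<close> is kept: only its value at \<open>s\<close> becomes
  meaningless, and \<open>s\<close> is no longer a vertex.
\<close>

definition remove_source :: "'v doag \<Rightarrow> 'v \<Rightarrow> 'v doag" where
  "remove_source G s =
     (let V' = verts G - {s};
          E' = edges G - out_edges G s;
          old = sources (verts G) (edges G) - {s};
          new = sources V' E' - sources (verts G) (edges G)
      in \<lparr> verts = V',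
           edges = E',
           out_order = out_order G,
           src_order =
             (src_order G \<inter> old \<times> old) \<union>
             old \<times> new \<union>
             {(u, v) \<in> new \<times> new. ((s, u), (s, v)) \<in> out_order G s} \<rparr>)"

primrec removal_sequence :: "nat \<Rightarrow> 'v doag \<Rightarrow> 'v list" where
  "removal_sequence 0 G = []"
| "removal_sequence (Suc k) G =
     smallest_source G # removal_sequence k (remove_source G (smallest_source G))"

text \<open>The vertex with label \<open>i \<in> {1..n}\<close> is the entry of index \<open>i - 1\<close> of this list.\<close>

definition decomposition_labelling :: "'v doag \<Rightarrow> 'v list" where
  "decomposition_labelling G = removal_sequence (card (verts G)) G"


section \<open>Labelled transition matrices\<close>

text \<open>The position, counted from 1, of \<open>(u, v)\<close> among the outgoing edges of \<open>u\<close>.\<close>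

definition out_position :: "'v doag \<Rightarrow> 'v \<times> 'v \<Rightarrow> nat" where
  "out_position G e = card {f \<in> out_edges G (fst e). f = e \<or> (f, e) \<in> out_order G (fst e)}"

text \<open>
  Matrices and lists of the library are indexed from 0, so the row and column
  indices \<open>i\<close> and \<open>j\<close> below stand for the labels \<open>i + 1\<close> and \<open>j + 1\<close>.
\<close>

definition labelled_transition_matrix :: "'v doag \<Rightarrow> int mat" where
  "labelled_transition_matrix G =
     (let n = card (verts G); l = decomposition_labelling G
      in mat n n (\<lambda>(i, j). if (l ! i, l ! j) \<in> edges G
                           then int (out_position G (l ! i, l ! j)) else 0))"


section \<open>Variation matrices\<close>

definition variation :: "int list \<Rightarrow> bool" where
  "variation xs \<longleftrightarrow>
     (\<forall>x \<in> set xs. 0 \<le> x) \<and>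
     (\<forall>k > 0. count_list xs k \<le> 1) \<and>
     (\<forall>i j. 0 < i \<and> i < j \<and> j \<in> set xs \<longrightarrow> i \<in> set xs)"

text \<open>
  The entry \<open>a\<^sub>i\<^sub>,\<^sub>j\<close> with indices counted from 1; only used for \<open>i\<close> and \<open>j\<close> at least 1.
\<close>

definition entry :: "int mat \<Rightarrow> nat \<Rightarrow> nat \<Rightarrow> int" where
  "entry A i j = A $$ (i - 1, j - 1)"

definition variation_matrix :: "nat \<Rightarrow> int mat \<Rightarrow> bool" where
  "variation_matrix n A \<longleftrightarrow>
     A \<in> carrier_mat n n \<and>
     (\<forall>i \<in> {1..n}. \<forall>j \<in> {1..n}. j \<le> i \<longrightarrow> entry A i j = 0) \<and>
     (\<forall>i. 1 \<le> i \<and> i < n \<longrightarrow> variation (map (entry A i) [i + 1 ..< n + 1]))"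

text \<open>The number \<open>b\<^sub>j\<close>, with rows and columns counted from 1.\<close>

definition last_positive_row :: "int mat \<Rightarrow> nat \<Rightarrow> nat" where
  "last_positive_row A j =
     (if \<exists>i \<in> {1..dim_row A}. entry A i j > 0
      then Max {i \<in> {1..dim_row A}. entry A i j > 0} else 0)"

end

theory Submission
  imports Defs
begin

text \<open>
  The list of vertices produced by the decomposition is the only list \<open>l\<close> without
  repetitions such that: edges go forward in \<open>l\<close>; sources occur in their given order; the position
  of the last parent increases weakly along \<open>l\<close>; and vertices with the same last parent are ordered
  as children of it.  Indeed a vertex becomes a source exactly when its last parent is removed, so
  vertices uncovered earlier are removed earlier, and vertices uncovered together are removed in
  the order of the edges from the common last parent.  These four properties of \<open>s # l\<close> pass to \<open>l\<close> after
  the removal of \<open>s\<close>, and conversely, which gives the characterization by induction.  On the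
  matrix the last two properties are conditions (i) and (ii); a variation matrix satisfying
  them is realized by taking positive entries as edges and the order of the
  indices on the sources.
\<close>

section \<open>Finite strict total orders\<close>

lemma strict_total_order_onD:
  assumes "strict_total_order_on S r"
  shows "\<And>x y. (x, y) \<in> r \<Longrightarrow> x \<in> S \<and> y \<in> S"
    and "\<And>x. (x, x) \<notin> r"
    and "\<And>x y z. (x, y) \<in> r \<Longrightarrow> (y, z) \<in> r \<Longrightarrow> (x, z) \<in> r"
    and "\<And>x y. x \<in> S \<Longrightarrow> y \<in> S \<Longrightarrow> x \<noteq> y \<Longrightarrow> (x, y) \<in> r \<or> (y, x) \<in> r"
    and "\<And>x y. (x, y) \<in> r \<Longrightarrow> (y, x) \<notin> r"
  using assms unfolding strict_total_order_on_def strict_linear_order_on_def trans_def irrefl_def total_on_def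
  by blast+

lemma strict_total_order_onI:
  assumes "\<And>x y. (x, y) \<in> r \<Longrightarrow> x \<in> S \<and> y \<in> S"
    and "\<And>x. (x, x) \<notin> r"
    and "\<And>x y z. (x, y) \<in> r \<Longrightarrow> (y, z) \<in> r \<Longrightarrow> (x, z) \<in> r"
    and "\<And>x y. x \<in> S \<Longrightarrow> y \<in> S \<Longrightarrow> x \<noteq> y \<Longrightarrow> (x, y) \<in> r \<or> (y, x) \<in> r"
  shows "strict_total_order_on S r"
proof -
  have "r \<subseteq> S \<times> S" using assms(1) by auto
  moreover have "trans r" using assms(3) by (rule transI)
  moreover have "irrefl r" using assms(2) by (simp add: irrefl_def)
  moreover have "total_on S r" using assms(4) by (auto simp: total_on_def)
  ultimately show ?thesis by (simp add: strict_total_order_on_def strict_linear_order_on_def)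
qed

lemma strict_total_order_on_restrict:
  assumes "strict_total_order_on S r" "T \<subseteq> S"
  shows "strict_total_order_on T (r \<inter> T \<times> T)"
proof -
  note r = strict_total_order_onD[OF assms(1)]
  show ?thesis
  proof (rule strict_total_order_onI)
    show "(x, z) \<in> r \<inter> T \<times> T" if "(x, y) \<in> r \<inter> T \<times> T" "(y, z) \<in> r \<inter> T \<times> T" for x y z
      using that r(3)[of x y z] by auto
    show "(x, y) \<in> r \<inter> T \<times> T \<or> (y, x) \<in> r \<inter> T \<times> T" if "x \<in> T" "y \<in> T" "x \<noteq> y" for x y
      using that assms(2) r(4)[of x y] by auto
  qed (use r(2) in auto)
qed

text \<open>This is the ordinal sum. It is needed for the source order after a removal, where the
  newly uncovered sources come after all old ones.\<close>

lemma strict_total_order_on_append: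
  assumes "strict_total_order_on S r" "strict_total_order_on T q" "S \<inter> T = {}"
  shows "strict_total_order_on (S \<union> T) (r \<union> S \<times> T \<union> q)"
proof -
  note r = strict_total_order_onD[OF assms(1)] and q = strict_total_order_onD[OF assms(2)]
  show ?thesis
  proof (rule strict_total_order_onI)
    show "(x, z) \<in> r \<union> S \<times> T \<union> q"
      if "(x, y) \<in> r \<union> S \<times> T \<union> q" "(y, z) \<in> r \<union> S \<times> T \<union> q" for x y z
      using that assms(3) r(1)[of x y] r(1)[of y z] q(1)[of x y] q(1)[of y z] r(3)[of x y z] q(3)[of x y z]
      by auto
    show "(x, y) \<in> r \<union> S \<times> T \<union> q \<or> (y, x) \<in> r \<union> S \<times> T \<union> q"
      if "x \<in> S \<union> T" "y \<in> S \<union> T" "x \<noteq> y" for x y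
      using that r(4)[of x y] q(4)[of x y] by auto
  qed (use assms(3) r(2) q(2) in \<open>auto dest: r(1) q(1)\<close>)
qed

text \<open>With \<open>f w = (s, w)\<close> this transports the order on the out-edges of
  \<open>s\<close> to the children of \<open>s\<close>, which is how newly uncovered sources are
  compared.\<close>

lemma strict_total_order_on_vimage:
  assumes "strict_total_order_on S r" "inj_on f T" "f ` T \<subseteq> S"
  shows "strict_total_order_on T {(u, v) \<in> T \<times> T. (f u, f v) \<in> r}"
proof (rule strict_total_order_onI)
  note r = strict_total_order_onD[OF assms(1)]
  show "(x, x) \<notin> {(u, v) \<in> T \<times> T. (f u, f v) \<in> r}" for x using r(2) by simp
  show "(x, z) \<in> {(u, v) \<in> T \<times> T. (f u, f v) \<in> r}"
    if "(x, y) \<in> {(u, v) \<in> T \<times> T. (f u, f v) \<in> r}" "(y, z) \<in> {(u, v) \<in> T \<times> T. (f u, f v) \<in> r}" for x y z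
    using that r(3)[of "f x" "f y" "f z"] by auto
  fix x y assume "x \<in> T" "y \<in> T" "x \<noteq> y"
  then show "(x, y) \<in> {(u, v) \<in> T \<times> T. (f u, f v) \<in> r} \<or> (y, x) \<in> {(u, v) \<in> T \<times> T. (f u, f v) \<in> r}"
    using strict_total_order_onD(4)[OF assms(1), of "f x" "f y"] assms(2,3)
    by (auto dest: inj_onD)
qed auto

text \<open>A transitive irreflexive relation is acyclic, and on a finite set also well-founded. A
  minimal element of \<open>S\<close> is then least by totality.\<close>

lemma strict_total_order_on_ex_least:
  assumes "strict_total_order_on S r" "finite S" "S \<noteq> {}"
  obtains s where "s \<in> S" "\<And>t. t \<in> S \<Longrightarrow> t \<noteq> s \<Longrightarrow> (s, t) \<in> r"
proof -
  note r = strict_total_order_onD[OF assms(1)]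
  have "r \<subseteq> S \<times> S" using r(1) by auto
  then have "finite r" using assms(2) finite_subset by blast
  moreover have "acyclic r"
    using r(2,3) by (simp add: acyclic_irrefl trans_def irrefl_def trancl_id)
  ultimately have "wf r" by (rule finite_acyclic_wf)
  then obtain s where "s \<in> S" "\<And>y. (y, s) \<in> r \<Longrightarrow> y \<notin> S"
    using assms(3) by (metis wf_eq_minimal ex_in_conv)
  with r(4) that show thesis by metis
qed

text \<open>An element of \<open>S\<close> counts itself, so positions start at 1; the shape is that
  of \<open>out_position\<close>.\<close>

definition rank :: "'a set \<Rightarrow> 'a rel \<Rightarrow> 'a \<Rightarrow> nat" where
  "rank S r e = card {f \<in> S. f = e \<or> (f, e) \<in> r}"

text \<open>If \<open>(x, y)\<close> is in \<open>r\<close>, the elements up to \<open>x\<close>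
  form a proper subset of those up to \<open>y\<close>, since \<open>y\<close> belongs only to the
  latter. Totality gives the converse.\<close>

lemma rank_less_iff:
  assumes "strict_total_order_on S r" "finite S" "e \<in> S" "f \<in> S"
  shows "rank S r e < rank S r f \<longleftrightarrow> (e, f) \<in> r"
proof -
  note r = strict_total_order_onD[OF assms(1)]
  have *: "rank S r x < rank S r y" if "(x, y) \<in> r" for x y
    unfolding rank_def
  proof (rule psubset_card_mono)
    have "y \<in> {f \<in> S. f = y \<or> (f, y) \<in> r}" "y \<notin> {f \<in> S. f = x \<or> (f, x) \<in> r}"
      using r(1)[OF that] r(5)[OF that] r(2)[of y] that by auto
    moreover have "{f \<in> S. f = x \<or> (f, x) \<in> r} \<subseteq> {f \<in> S. f = y \<or> (f, y) \<in> r}"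
      using r(3)[OF _ that] that by auto
    ultimately show "{f \<in> S. f = x \<or> (f, x) \<in> r} \<subset> {f \<in> S. f = y \<or> (f, y) \<in> r}"
      by blast
  qed (use assms(2) in simp)
  show ?thesis
  proof (cases "e = f")
    case False
    then show ?thesis using *[of e f] *[of f e] r(4)[OF assms(3,4)] by (meson less_asym)
  qed (simp add: r(2))
qed

text \<open>Distinct elements are comparable, so their ranks differ; all ranks lie between 1 and
  \<open>card S\<close>, and an injection between finite sets of equal size is onto.\<close>

lemma rank_bij:
  assumes "strict_total_order_on S r" "finite S"
  shows "bij_betw (rank S r) S {1..card S}"
proof -
  note r = strict_total_order_onD[OF assms(1)]
  have inj: "inj_on (rank S r) S"
  proof (rule inj_onI, rule ccontr)
    fix x y assume xy: "x \<in> S" "y \<in> S" "rank S r x = rank S r y" "x \<noteq> y"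
    then show False
      using r(4)[OF xy(1,2,4)] rank_less_iff[OF assms xy(1,2)] rank_less_iff[OF assms xy(2,1)] by simp
  qed
  have "rank S r ` S \<subseteq> {1..card S}"
  proof
    fix k assume "k \<in> rank S r ` S"
    then obtain e where "e \<in> S" "k = rank S r e" by blast
    moreover from this have "rank S r e > 0"
      unfolding rank_def using assms(2) by (subst card_gt_0_iff) auto
    moreover have "rank S r e \<le> card S"
      unfolding rank_def using assms(2) by (intro card_mono) auto
    ultimately show "k \<in> {1..card S}" by simp
  qed
  then have "rank S r ` S = {1..card S}"
    using inj by (intro card_subset_eq) (auto simp: card_image)
  with inj show ?thesis by (simp add: bij_betw_def)
qed

section \<open>Precedence in a list\<close>

text \<open>This is a strict linear order on \<open>set l\<close> only for lists without
  repetitions, and it fails whenever \<open>u\<close> or \<open>v\<close> does not occur in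
  \<open>l\<close>.\<close>

definition precedes :: "'a list \<Rightarrow> 'a \<Rightarrow> 'a \<Rightarrow> bool" where
  "precedes l u v \<longleftrightarrow> (\<exists>i j. i < j \<and> j < length l \<and> l ! i = u \<and> l ! j = v)"

lemma precedes_Nil [simp]: "\<not> precedes [] u v"
  by (simp add: precedes_def)

lemma precedes_Cons [simp]:
  "precedes (s # l) u v \<longleftrightarrow> u = s \<and> v \<in> set l \<or> precedes l u v"
proof
  assume "precedes (s # l) u v"
  then obtain i j where ij: "i < j" "j < Suc (length l)" "(s # l) ! i = u" "(s # l) ! j = v"
    by (auto simp: precedes_def)
  then obtain j' where "j = Suc j'" by (cases j) auto
  with ij show "u = s \<and> v \<in> set l \<or> precedes l u v"
    by (cases i) (auto simp: precedes_def)
next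
  assume "u = s \<and> v \<in> set l \<or> precedes l u v"
  then show "precedes (s # l) u v"
  proof
    assume "u = s \<and> v \<in> set l"
    then obtain j where "j < length l" "l ! j = v" "u = s" by (auto simp: in_set_conv_nth)
    then show ?thesis unfolding precedes_def by (intro exI[of _ 0] exI[of _ "Suc j"]) simp
  next
    assume "precedes l u v"
    then obtain i j where "i < j" "j < length l" "l ! i = u" "l ! j = v"
      by (auto simp: precedes_def)
    then show ?thesis unfolding precedes_def by (intro exI[of _ "Suc i"] exI[of _ "Suc j"]) simp
  qed
qed

lemma precedes_in_set: "precedes l u v \<Longrightarrow> u \<in> set l \<and> v \<in> set l"
  by (auto simp: precedes_def)

lemma precedes_nth_iff:
  "distinct l \<Longrightarrow> i < length l \<Longrightarrow> j < length l \<Longrightarrow> precedes l (l ! i) (l ! j) \<longleftrightarrow> i < j"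
  by (auto simp: precedes_def nth_eq_iff_index_eq)

lemma precedes_antisym:
  assumes "distinct l" "precedes l u v"
  shows "\<not> precedes l v u"
proof -
  obtain i j where "i < j" "j < length l" "u = l ! i" "v = l ! j"
    using assms(2) by (auto simp: precedes_def)
  with assms(1) show ?thesis by (simp add: precedes_nth_iff)
qed

lemma precedes_trans:
  assumes "distinct l" "precedes l u v" "precedes l v w"
  shows "precedes l u w"
proof -
  obtain i j where "i < j" "j < length l" "u = l ! i" "v = l ! j"
    using assms(2) by (auto simp: precedes_def)
  moreover obtain j' k where "j' < k" "k < length l" "v = l ! j'" "w = l ! k"
    using assms(3) by (auto simp: precedes_def)
  ultimately show ?thesis using assms(1) by (auto simp: precedes_nth_iff nth_eq_iff_index_eq)
qed

lemma acyclic_precedes: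
  assumes "distinct l"
  shows "acyclic {(u, v). precedes l u v}"
proof -
  have "trans {(u, v). precedes l u v}"
    using precedes_trans[OF assms] by (auto intro: transI)
  then show ?thesis
    using precedes_antisym[OF assms] by (auto simp: acyclic_irrefl trancl_id irrefl_def)
qed

lemma precedes_linear:
  "u \<in> set l \<Longrightarrow> v \<in> set l \<Longrightarrow> u \<noteq> v \<Longrightarrow> precedes l u v \<or> precedes l v u"
  by (auto simp: precedes_def in_set_conv_nth) (metis nat_neq_iff)

section \<open>Removal of sources\<close>

lemma finite_out_edges: "is_doag G \<Longrightarrow> finite (out_edges G v)"
  unfolding is_doag_def out_edges_def
  by (metis (no_types, lifting) finite_SigmaI finite_subset mem_Collect_eq subsetI)

lemma smallest_source_eqI:
  assumes "is_doag G" "s \<in> sources (verts G) (edges G)"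
    and "\<And>t. t \<in> sources (verts G) (edges G) \<Longrightarrow> t \<noteq> s \<Longrightarrow> (s, t) \<in> src_order G"
  shows "smallest_source G = s"
  unfolding smallest_source_def
proof (rule the_equality)
  have "strict_total_order_on (sources (verts G) (edges G)) (src_order G)"
    using assms(1) by (simp add: is_doag_def)
  note r = strict_total_order_onD(5)[OF this]
  show "t = s" if "t \<in> sources (verts G) (edges G) \<and>
      (\<forall>u \<in> sources (verts G) (edges G). u \<noteq> t \<longrightarrow> (t, u) \<in> src_order G)" for t
  proof (rule ccontr)
    assume "t \<noteq> s"
    then show False using that assms(2) assms(3)[of t] r[of s t] by simp
  qed
qed (use assms in blast)

text \<open>The edge relation is finite and acyclic, hence well-founded; a minimal vertex is a
  source, so the finite order on the sources has a least element and \<open>THE\<close> is well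
  defined.\<close>

lemma smallest_source_least:
  assumes "is_doag G" "verts G \<noteq> {}"
  shows "smallest_source G \<in> sources (verts G) (edges G)"
    and "\<And>t. t \<in> sources (verts G) (edges G) \<Longrightarrow> t \<noteq> smallest_source G \<Longrightarrow>
           (smallest_source G, t) \<in> src_order G"
proof -
  let ?S = "sources (verts G) (edges G)"
  have fin: "finite (verts G)" and E: "edges G \<subseteq> verts G \<times> verts G" and "acyclic (edges G)"
    and ord: "strict_total_order_on ?S (src_order G)"
    using assms(1) by (auto simp: is_doag_def)
  then have "wf (edges G)" by (meson finite_SigmaI finite_acyclic_wf finite_subset)
  then obtain v where "v \<in> verts G" "\<And>u. (u, v) \<in> edges G \<Longrightarrow> u \<notin> verts G"
    using assms(2) by (metis wf_eq_minimal ex_in_conv)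
  then have "v \<in> ?S" using E by (auto simp: sources_def)
  moreover have "finite ?S" using fin by (simp add: sources_def)
  ultimately obtain s where s: "s \<in> ?S" "\<And>t. t \<in> ?S \<Longrightarrow> t \<noteq> s \<Longrightarrow> (s, t) \<in> src_order G"
    using strict_total_order_on_ex_least[OF ord] by blast
  then have "smallest_source G = s" by (rule smallest_source_eqI[OF assms(1)])
  with s show "smallest_source G \<in> ?S"
    "\<And>t. t \<in> ?S \<Longrightarrow> t \<noteq> smallest_source G \<Longrightarrow> (smallest_source G, t) \<in> src_order G" by auto
qed

section \<open>The graph left after the removal of a source\<close>

lemma remove_source_simps [simp]:
  "verts (remove_source G s) = verts G - {s}"
  "out_order (remove_source G s) = out_order G"
  by (simp_all add: remove_source_def Let_def)

lemma edge_remove_source_iff [simp]: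
  "(u, v) \<in> edges (remove_source G s) \<longleftrightarrow> (u, v) \<in> edges G \<and> u \<noteq> s"
  by (auto simp: remove_source_def Let_def out_edges_def)

lemma src_order_remove_source_iff:
  fixes G s
  defines "S \<equiv> sources (verts G) (edges G)"
    and "S' \<equiv> sources (verts (remove_source G s)) (edges (remove_source G s))"
  shows "(u, v) \<in> src_order (remove_source G s) \<longleftrightarrow>
    u \<in> S - {s} \<and> v \<in> S - {s} \<and> (u, v) \<in> src_order G \<or>
    u \<in> S - {s} \<and> v \<in> S' - S \<or>
    u \<in> S' - S \<and> v \<in> S' - S \<and> ((s, u), (s, v)) \<in> out_order G s"
  by (auto simp: remove_source_def Let_def S_def S'_def)

text \<open>Only edges leaving \<open>s\<close> are deleted, so an edge that kept \<open>v\<close>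
  from being a source before must start at \<open>s\<close>.\<close>

lemma new_source_is_child:
  assumes "v \<in> sources (verts (remove_source G s)) (edges (remove_source G s))"
    and "v \<notin> sources (verts G) (edges G)"
  shows "(s, v) \<in> edges G"
  using assms by (auto simp: sources_def)

lemma parent_of_source_remove_source:
  assumes "v \<in> sources (verts (remove_source G s)) (edges (remove_source G s))" "(q, v) \<in> edges G"
  shows "q = s"
  using assms by (auto simp: sources_def)

text \<open>Vertices, edges and out-orders are restricted. The new source order is the ordinal sum
  of the old order on the remaining sources and the order of the newly uncovered ones as children of
  \<open>s\<close>.\<close>

lemma is_doag_remove_source:
  assumes G: "is_doag G" and s: "s \<in> sources (verts G) (edges G)"
  shows "is_doag (remove_source G s)"
proof -
  let ?G = "remove_source G s"
  let ?S = "sources (verts G) (edges G)" and ?S' = "sources (verts ?G) (edges ?G)"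
  have sub: "edges ?G \<subseteq> edges G" by auto
  have out: "out_edges ?G v = out_edges G v" if "v \<noteq> s" for v
    using that by (auto simp: out_edges_def)
  have E: "edges ?G \<subseteq> verts ?G \<times> verts ?G"
    using G s by (auto simp: is_doag_def sources_def)
  \<comment> \<open>Deleting edges creates no parents, so every old source other than
    \<open>s\<close> remains a source.\<close>
  have split: "?S' = (?S - {s}) \<union> (?S' - ?S)"
    by (auto simp: sources_def)
  have 1: "strict_total_order_on (?S - {s}) (src_order G \<inter> (?S - {s}) \<times> (?S - {s}))"
    using G by (intro strict_total_order_on_restrict[of ?S]) (auto simp: is_doag_def)
  have "strict_total_order_on (out_edges G s) (out_order G s)"
    using G s by (auto simp: is_doag_def sources_def)
  then have 2: "strict_total_order_on (?S' - ?S)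
      {(u, v) \<in> (?S' - ?S) \<times> (?S' - ?S). ((s, u), (s, v)) \<in> out_order G s}"
    by (rule strict_total_order_on_vimage)
       (use new_source_is_child[of _ G s] in \<open>auto simp: inj_on_def out_edges_def\<close>)
  have "src_order ?G = (src_order G \<inter> (?S - {s}) \<times> (?S - {s})) \<union> (?S - {s}) \<times> (?S' - ?S) \<union>
      {(u, v) \<in> (?S' - ?S) \<times> (?S' - ?S). ((s, u), (s, v)) \<in> out_order G s}"
    by (auto simp: src_order_remove_source_iff)
  then have "strict_total_order_on ?S' (src_order ?G)"
    using strict_total_order_on_append[OF 1 2] split by auto
  moreover have "acyclic (edges ?G)"
    using G sub acyclic_subset by (auto simp: is_doag_def)
  ultimately show ?thesis using G E out by (auto simp: is_doag_def)
qed

section \<open>Characterization of the decomposition labelling\<close>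

text \<open>When \<open>l\<close> lists the vertices in removal order, \<open>p\<close> is the
  vertex whose removal turns \<open>u\<close> into a source.\<close>

definition last_parent :: "('v \<times> 'v) set \<Rightarrow> 'v list \<Rightarrow> 'v \<Rightarrow> 'v \<Rightarrow> bool" where
  "last_parent E l p u \<longleftrightarrow> (p, u) \<in> E \<and> (\<forall>q. (q, u) \<in> E \<longrightarrow> q = p \<or> precedes l q p)"

text \<open>Monotonicity of the position of the last parent, phrased without naming that parent:
  each parent of \<open>u\<close> is matched or surpassed by a parent of \<open>v\<close>. A vertex
  without parents thus behaves as if its value were 0, as in the definition of
  \<open>b\<close>.\<close>

definition parents_mono :: "'v doag \<Rightarrow> 'v list \<Rightarrow> bool" where
  "parents_mono G l \<longleftrightarrow> (\<forall>u v p. precedes l u v \<and> (p, u) \<in> edges G \<longrightarrow>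
     (\<exists>q. (q, v) \<in> edges G \<and> (p = q \<or> precedes l p q)))"

text \<open>All pairs with a common last parent are compared here, whereas condition (ii) compares
  neighbouring columns only.\<close>

definition ties_ordered :: "'v doag \<Rightarrow> 'v list \<Rightarrow> bool" where
  "ties_ordered G l \<longleftrightarrow> (\<forall>u v p. precedes l u v \<and>
     last_parent (edges G) l p u \<and> last_parent (edges G) l p v \<longrightarrow>
     ((p, u), (p, v)) \<in> out_order G p)"

text \<open>Sources have no last parent to break ties between them, so their order is prescribed by
  a separate clause.\<close>

definition removal_order :: "'v doag \<Rightarrow> 'v list \<Rightarrow> bool" where
  "removal_order G l \<longleftrightarrow> distinct l \<and> set l = verts G \<and>
     (\<forall>u v. (u, v) \<in> edges G \<longrightarrow> precedes l u v) \<and>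
     (\<forall>u v. u \<in> sources (verts G) (edges G) \<and> v \<in> sources (verts G) (edges G) \<and> precedes l u v \<longrightarrow>
        (u, v) \<in> src_order G) \<and>
     parents_mono G l \<and> ties_ordered G l"

section \<open>Passing between a removal order and its tail\<close>

lemma removal_orderD:
  assumes "removal_order G l"
  shows "distinct l" "set l = verts G"
    and "(u, v) \<in> edges G \<Longrightarrow> precedes l u v"
    and "u \<in> sources (verts G) (edges G) \<Longrightarrow> v \<in> sources (verts G) (edges G) \<Longrightarrow> precedes l u v \<Longrightarrow>
      (u, v) \<in> src_order G"
    and "precedes l u v \<Longrightarrow> (p, u) \<in> edges G \<Longrightarrow>
      \<exists>q. (q, v) \<in> edges G \<and> (p = q \<or> precedes l p q)"
    and "precedes l u v \<Longrightarrow> last_parent (edges G) l p u \<Longrightarrow> last_parent (edges G) l p v \<Longrightarrow>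
      ((p, u), (p, v)) \<in> out_order G p"
  using assms unfolding removal_order_def parents_mono_def ties_ordered_def by blast+

text \<open>Edges go forward, so none enters the head \<open>s\<close>; since \<open>s\<close>
  precedes every other source, it is the smallest one. For the tail, the new source order is
  recovered from the order of the old sources, from \<open>parents_mono\<close> and from the ties at
  \<open>s\<close>.\<close>

lemma removal_order_ConsD:
  assumes G: "is_doag G" and l: "removal_order G (s # l)"
  shows "s \<in> sources (verts G) (edges G)" "smallest_source G = s"
    "removal_order (remove_source G s) l"
proof -
  let ?G = "remove_source G s"
  let ?S = "sources (verts G) (edges G)" and ?S' = "sources (verts ?G) (edges ?G)"
  note D = removal_orderD[OF l]
  have dist: "distinct l" "s \<notin> set l" and set: "verts G = insert s (set l)"
    using D(1,2) by auto
  have topo: "u = s \<and> v \<in> set l \<or> precedes l u v" if "(u, v) \<in> edges G" for u v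
    using D(3)[OF that] by simp
  have src: "(u, v) \<in> src_order G"
    if "u \<in> ?S" "v \<in> ?S" "u = s \<and> v \<in> set l \<or> precedes l u v" for u v
    using D(4)[of u v] that by simp
  have mono: "\<exists>q. (q, v) \<in> edges G \<and> (p = q \<or> p = s \<and> q \<in> set l \<or> precedes l p q)"
    if "precedes l u v" "(p, u) \<in> edges G" for u v p
    using D(5)[of u v p] that by simp
  have ties: "((p, u), (p, v)) \<in> out_order G p"
    if "precedes l u v" "last_parent (edges G) (s # l) p u" "last_parent (edges G) (s # l) p v" for u v p
    using D(6)[of u v p] that by simp
  show s: "s \<in> ?S"
    using set topo dist precedes_in_set by (fastforce simp: sources_def)
  show "smallest_source G = s"
    by (rule smallest_source_eqI[OF G s]) (use s set src in \<open>auto simp: sources_def\<close>)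
  have topo': "precedes l u v" if "(u, v) \<in> edges ?G" for u v
    using that topo by auto
  have "(u, v) \<in> src_order ?G" if u: "u \<in> ?S'" and v: "v \<in> ?S'" and uv: "precedes l u v" for u v
  proof (cases "u \<in> ?S")
    case True
    with u v uv src show ?thesis
      by (auto simp: src_order_remove_source_iff) (auto simp: sources_def)
  next
    case False
    \<comment> \<open>As \<open>u\<close> has the parent \<open>s\<close>, monotonicity gives
      \<open>v\<close> a parent too, so \<open>v\<close> is not an old source. Both vertices have
      \<open>s\<close> as their only parent, and the tie at \<open>s\<close> decides.\<close>
    with u have su: "(s, u) \<in> edges G" using new_source_is_child[of _ G s] by blast
    then obtain q where "(q, v) \<in> edges G" using mono[OF uv] by blast
    then have v': "v \<notin> ?S" by (auto simp: sources_def)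
    with v have sv: "(s, v) \<in> edges G" using new_source_is_child[of _ G s] by blast
    have "last_parent (edges G) (s # l) s u" "last_parent (edges G) (s # l) s v"
      unfolding last_parent_def
      using su sv parent_of_source_remove_source[OF u] parent_of_source_remove_source[OF v] by blast+
    then have "((s, u), (s, v)) \<in> out_order G s" using ties uv by blast
    then show ?thesis using u v False v' by (auto simp: src_order_remove_source_iff)
  qed
  moreover have "parents_mono ?G l"
    unfolding parents_mono_def
  proof (intro allI impI, elim conjE)
    fix u v p assume "precedes l u v" "(p, u) \<in> edges ?G"
    then obtain q where q: "(q, v) \<in> edges G" "p = q \<or> precedes l p q" "p \<noteq> s"
      using mono[of u v p] dist by auto
    \<comment> \<open>Either \<open>q\<close> is \<open>p\<close>, which is not \<open>s\<close>, or
      \<open>q\<close> occurs in \<open>l\<close>, which does not contain \<open>s\<close>. Hence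
      the edge from \<open>q\<close> survives the removal.\<close>
    moreover have "q \<noteq> s" using q dist precedes_in_set[of l p q] by auto
    ultimately show "\<exists>q. (q, v) \<in> edges ?G \<and> (p = q \<or> precedes l p q)" by auto
  qed
  moreover have "ties_ordered ?G l"
    unfolding ties_ordered_def
  proof (intro allI impI, elim conjE)
    fix u v p assume uv: "precedes l u v" and
      p: "last_parent (edges ?G) l p u" "last_parent (edges ?G) l p v"
    have "p \<in> set l" using p(1) topo'[of p u] precedes_in_set[of l p u] by (auto simp: last_parent_def)
    \<comment> \<open>The only parent that can be added in \<open>G\<close> is \<open>s\<close>, and
      it precedes \<open>p\<close> in \<open>s # l\<close>.\<close>
    then have "last_parent (edges G) (s # l) p w" if "last_parent (edges ?G) l p w" for w
      using that by (auto simp: last_parent_def)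
    then show "((p, u), (p, v)) \<in> out_order ?G p" using ties[OF uv] p by simp
  qed
  ultimately show "removal_order ?G l"
    using dist set topo' unfolding removal_order_def by auto
qed

text \<open>Everything that does not involve \<open>s\<close> is inherited from the tail. For the
  parent \<open>s\<close>, monotonicity holds because the new source order puts uncovered vertices
  after old sources, and ties hold because it compares uncovered vertices as children of
  \<open>s\<close>.\<close>

lemma removal_order_ConsI:
  assumes G: "is_doag G" and s: "s \<in> sources (verts G) (edges G)"
    and least: "\<And>t. t \<in> sources (verts G) (edges G) \<Longrightarrow> t \<noteq> s \<Longrightarrow> (s, t) \<in> src_order G"
    and l: "removal_order (remove_source G s) l"
  shows "removal_order G (s # l)"
proof -
  let ?G = "remove_source G s"
  let ?S = "sources (verts G) (edges G)" and ?S' = "sources (verts ?G) (edges ?G)"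
  have E: "edges G \<subseteq> verts G \<times> verts G" using G by (simp add: is_doag_def)
  have sv: "s \<in> verts G" and no: "(u, s) \<notin> edges G" for u
    using s by (auto simp: sources_def)
  note D = removal_orderD[OF l]
  note dist = D(1) and src = D(4)
  have set: "set l = verts G - {s}" using D(2) by simp
  have topo: "precedes l u v" if "(u, v) \<in> edges G" "u \<noteq> s" for u v
    using D(3)[of u v] that by simp
  have mono: "\<exists>q. (q, v) \<in> edges G \<and> q \<noteq> s \<and> (p = q \<or> precedes l p q)"
    if "precedes l u v" "(p, u) \<in> edges G" "p \<noteq> s" for u v p
    using D(5)[of u v p] that by auto
  have ties: "((p, u), (p, v)) \<in> out_order G p"
    if "precedes l u v" "last_parent (edges ?G) l p u" "last_parent (edges ?G) l p v" for u v p
    using D(6)[of u v p] that by simp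
  have not_s: "u \<noteq> s" "v \<noteq> s" if "precedes l u v" for u v
    using precedes_in_set[OF that] set by auto
  have "precedes (s # l) u v" if "(u, v) \<in> edges G" for u v
    using that topo[OF that] E no set by (cases "u = s") auto
  moreover have "(u, v) \<in> src_order G" if "u \<in> ?S" "v \<in> ?S" "precedes (s # l) u v" for u v
  proof (cases "u = s")
    case True
    then show ?thesis using that least set not_s by auto
  next
    case False
    then have uv: "precedes l u v" using that by simp
    then have "u \<in> ?S'" "v \<in> ?S'" using that not_s by (auto simp: sources_def)
    then show ?thesis using src[OF _ _ uv] that by (auto simp: src_order_remove_source_iff)
  qed
  moreover have "parents_mono G (s # l)"
    unfolding parents_mono_def
  proof (intro allI impI, elim conjE)
    fix u v p assume uv: "precedes (s # l) u v" and p: "(p, u) \<in> edges G"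
    have uv: "precedes l u v" using uv p no by auto
    show "\<exists>q. (q, v) \<in> edges G \<and> (p = q \<or> precedes (s # l) p q)"
    proof (cases "p = s")
      case False
      with mono[OF uv p] show ?thesis by auto
    next
      case True
      \<comment> \<open>Any parent of \<open>v\<close> will do, since \<open>s\<close> comes first.
        If \<open>v\<close> had none, \<open>v\<close> would be an old source and, by
        \<open>mono\<close>, \<open>u\<close> would have no parent besides \<open>s\<close>; then
        the new source order would put \<open>v\<close> below \<open>u\<close>, although
        \<open>u\<close> precedes \<open>v\<close>.\<close>
      have "\<exists>q. (q, v) \<in> edges G"
      proof (rule ccontr)
        assume *: "\<nexists>q. (q, v) \<in> edges G"
        have "v \<in> ?S" using * precedes_in_set[OF uv] set by (auto simp: sources_def)
        moreover have "u \<in> ?S'"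
          using mono[OF uv] * precedes_in_set[OF uv] set by (auto simp: sources_def)
        moreover have "u \<notin> ?S" using p by (auto simp: sources_def)
        moreover have "v \<in> ?S'" using * precedes_in_set[OF uv] set by (auto simp: sources_def)
        ultimately show False using src[OF _ _ uv] by (auto simp: src_order_remove_source_iff)
      qed
      then obtain q where "(q, v) \<in> edges G" by blast
      moreover from this have "q = s \<or> q \<in> set l" using E set by auto
      ultimately show ?thesis using True by auto
    qed
  qed
  moreover have "ties_ordered G (s # l)"
    unfolding ties_ordered_def
  proof (intro allI impI, elim conjE)
    fix u v p assume uv: "precedes (s # l) u v" and
      p: "last_parent (edges G) (s # l) p u" "last_parent (edges G) (s # l) p v"
    have uv: "precedes l u v" using uv p no by (auto simp: last_parent_def)
    show "((p, u), (p, v)) \<in> out_order G p"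
    proof (cases "p = s")
      case True
      \<comment> \<open>As \<open>s\<close> heads the list, it can be a last parent only by being
        the sole parent, so \<open>w\<close> is newly uncovered.\<close>
      have *: "w \<in> ?S' - ?S" if "last_parent (edges G) (s # l) p w" for w
      proof -
        have sw: "(s, w) \<in> edges G" using that True by (simp add: last_parent_def)
        moreover have "w \<noteq> s" "w \<in> verts G" using sw no E by auto
        moreover have "q = s" if q: "(q, w) \<in> edges G" for q
          using q that not_s(2)[of q s] set \<open>last_parent (edges G) (s # l) p w\<close> True
          by (auto simp: last_parent_def)
        ultimately show ?thesis
          unfolding sources_def Diff_iff mem_Collect_eq remove_source_simps edge_remove_source_iff by blast
      qed
      show ?thesis using src[OF _ _ uv] *[OF p(1)] *[OF p(2)] True
        by (auto simp: src_order_remove_source_iff)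
    next
      case False
      then have "last_parent (edges ?G) l p w" if "last_parent (edges G) (s # l) p w" for w
        using that by (auto simp: last_parent_def)
      then show ?thesis using ties[OF uv] p by blast
    qed
  qed
  ultimately show ?thesis
    using dist set sv unfolding removal_order_def by auto
qed

text \<open>By induction on the number of vertices: the head of a removal order must be the smallest
  source, and its tail is a removal order of the remaining graph. The equivalence yields existence
  and uniqueness of the removal order at once.\<close>

lemma removal_sequence_iff:
  assumes "is_doag G" "card (verts G) = n"
  shows "removal_sequence n G = l \<longleftrightarrow> removal_order G l"
  using assms
proof (induction n arbitrary: G l)
  case 0
  then have "verts G = {}" "edges G = {}" by (auto simp: is_doag_def)
  then show ?case
    by (auto simp: removal_order_def parents_mono_def ties_ordered_def last_parent_def)
next
  case (Suc n)
  let ?s = "smallest_source G"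
  have ne: "verts G \<noteq> {}" using Suc.prems by auto
  note s = smallest_source_least[OF Suc.prems(1) ne]
  have "is_doag (remove_source G ?s)" by (rule is_doag_remove_source[OF Suc.prems(1) s(1)])
  moreover have "card (verts (remove_source G ?s)) = n"
    using Suc.prems s(1) by (auto simp: sources_def is_doag_def)
  ultimately have IH: "removal_sequence n (remove_source G ?s) = l' \<longleftrightarrow>
      removal_order (remove_source G ?s) l'" for l'
    by (rule Suc.IH)
  show ?case
  proof
    assume "removal_sequence (Suc n) G = l"
    then obtain l' where "l = ?s # l'" "removal_order (remove_source G ?s) l'" using IH by auto
    then show "removal_order G l" using removal_order_ConsI[OF Suc.prems(1) s] by blast
  next
    assume l: "removal_order G l"
    then have "set l \<noteq> {}" using ne by (auto simp: removal_order_def)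
    then obtain t l' where "l = t # l'" by (cases l) auto
    with removal_order_ConsD[OF Suc.prems(1)] l IH show "removal_sequence (Suc n) G = l" by auto
  qed
qed

lemma decomposition_labelling_iff:
  "is_doag G \<Longrightarrow> decomposition_labelling G = l \<longleftrightarrow> removal_order G l"
  by (simp add: decomposition_labelling_def removal_sequence_iff)

lemma removal_order_length: "removal_order G l \<Longrightarrow> length l = card (verts G)"
  unfolding removal_order_def using distinct_card by metis

section \<open>Variation matrices with indices counted from 0\<close>

lemma count_list_map_eq_card:
  "distinct ys \<Longrightarrow> count_list (map f ys) k = card {y \<in> set ys. f y = k}"
proof (induction ys)
  case (Cons y ys)
  have "{z \<in> set (y # ys). f z = k} = (if f y = k then {y} else {}) \<union> {z \<in> set ys. f z = k}"
    by auto
  with Cons show ?case by auto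
qed simp

text \<open>A positive value occurring at most once means injectivity where \<open>f\<close> is
  positive; in the absence of gaps, the added case \<open>k = f y\<close> is trivial.\<close>

lemma variation_map_iff:
  assumes "distinct ys"
  shows "variation (map f ys) \<longleftrightarrow> (\<forall>y \<in> set ys. 0 \<le> f y) \<and>
     (\<forall>x \<in> set ys. \<forall>y \<in> set ys. f x = f y \<and> 0 < f x \<longrightarrow> x = y) \<and>
     (\<forall>y \<in> set ys. \<forall>k. 0 < k \<and> k \<le> f y \<longrightarrow> k \<in> f ` set ys)"
proof -
  have "count_list (map f ys) k \<le> 1 \<longleftrightarrow>
      (\<forall>x \<in> set ys. \<forall>y \<in> set ys. f x = k \<and> f y = k \<longrightarrow> x = y)" for k
    unfolding count_list_map_eq_card[OF assms] One_nat_def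
    by (subst card_le_Suc0_iff_eq) auto
  then have 1: "(\<forall>k > 0. count_list (map f ys) k \<le> 1) \<longleftrightarrow>
      (\<forall>x \<in> set ys. \<forall>y \<in> set ys. f x = f y \<and> 0 < f x \<longrightarrow> x = y)"
    by auto
  have "(\<forall>i j. 0 < i \<and> i < j \<and> j \<in> f ` set ys \<longrightarrow> i \<in> f ` set ys) \<longleftrightarrow>
      (\<forall>y \<in> set ys. \<forall>k. 0 < k \<and> k \<le> f y \<longrightarrow> k \<in> f ` set ys)"
    unfolding order_le_less by blast
  with 1 show ?thesis by (simp add: variation_def)
qed

text \<open>Full rows may replace the parts right of the diagonal, because the remaining entries are
  0 and zeros satisfy all three row conditions.\<close>

lemma variation_matrix_iff:
  "variation_matrix n A \<longleftrightarrow> A \<in> carrier_mat n n \<and>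
     (\<forall>i < n. \<forall>j \<le> i. A $$ (i, j) = 0) \<and>
     (\<forall>i < n. \<forall>j < n. 0 \<le> A $$ (i, j)) \<and>
     (\<forall>i < n. \<forall>j < n. \<forall>k < n. A $$ (i, j) = A $$ (i, k) \<and> 0 < A $$ (i, j) \<longrightarrow> j = k) \<and>
     (\<forall>i < n. \<forall>j < n. \<forall>k. 0 < k \<and> k \<le> A $$ (i, j) \<longrightarrow> (\<exists>m < n. A $$ (i, m) = k))"
proof -
  have tri: "(\<forall>i \<in> {1..n}. \<forall>j \<in> {1..n}. j \<le> i \<longrightarrow> entry A i j = 0) \<longleftrightarrow>
      (\<forall>i < n. \<forall>j \<le> i. A $$ (i, j) = 0)" (is "?L \<longleftrightarrow> ?R")
  proof
    assume L: ?L
    show ?R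
    proof (intro allI impI)
      fix i j assume "i < n" "j \<le> i"
      then show "A $$ (i, j) = 0" using L[rule_format, of "Suc i" "Suc j"] by (simp add: entry_def)
    qed
  next
    assume R: ?R
    show ?L
    proof (intro ballI impI)
      fix i j assume "i \<in> {1..n}" "j \<in> {1..n}" "j \<le> i"
      then show "entry A i j = 0" using R[rule_format, of "i - 1" "j - 1"] by (simp add: entry_def)
    qed
  qed
  have row: "variation (map (entry A (Suc i)) [Suc i + 1 ..< n + 1]) \<longleftrightarrow>
      (\<forall>j < n. 0 \<le> A $$ (i, j)) \<and>
      (\<forall>j < n. \<forall>k < n. A $$ (i, j) = A $$ (i, k) \<and> 0 < A $$ (i, j) \<longrightarrow> j = k) \<and>
      (\<forall>j < n. \<forall>k. 0 < k \<and> k \<le> A $$ (i, j) \<longrightarrow> (\<exists>m < n. A $$ (i, m) = k))"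
    if zero: "\<forall>j \<le> i. A $$ (i, j) = 0" for i
  proof -
    have "[Suc i + 1 ..< n + 1] = map Suc [Suc i ..< n]" by (simp add: map_Suc_upt)
    then have "map (entry A (Suc i)) [Suc i + 1 ..< n + 1] = map (\<lambda>j. A $$ (i, j)) [Suc i ..< n]"
      by (simp add: entry_def)
    moreover have ball: "(\<forall>j \<in> {Suc i..<n}. P j) \<longleftrightarrow> (\<forall>j < n. P j)" if "\<And>j. j \<le> i \<Longrightarrow> P j" for P
      using that by (metis atLeastLessThan_iff not_less_eq_eq)
    \<comment> \<open>Nonzero entries lie strictly right of the diagonal, so conditions on positive
      entries do not see the change of the index range.\<close>
    have low: "j \<in> {Suc i..<n} \<longleftrightarrow> j < n" if "A $$ (i, j) \<noteq> 0" for j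
      using that zero by (auto simp: not_less_eq_eq[symmetric])
    have "(\<forall>j \<in> {Suc i..<n}. 0 \<le> A $$ (i, j)) \<longleftrightarrow> (\<forall>j < n. 0 \<le> A $$ (i, j))"
      by (rule ball) (simp add: zero)
    moreover have "(\<forall>j \<in> {Suc i..<n}. \<forall>k \<in> {Suc i..<n}. A $$ (i, j) = A $$ (i, k) \<and> 0 < A $$ (i, j) \<longrightarrow> j = k)
        \<longleftrightarrow> (\<forall>j < n. \<forall>k < n. A $$ (i, j) = A $$ (i, k) \<and> 0 < A $$ (i, j) \<longrightarrow> j = k)"
      using low by (metis order_less_irrefl)
    moreover have "k \<in> (\<lambda>j. A $$ (i, j)) ` {Suc i..<n} \<longleftrightarrow> (\<exists>m < n. A $$ (i, m) = k)" if "0 < k" for k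
      using that low by (metis (no_types, lifting) image_iff order_less_irrefl)
    then have "(\<forall>j \<in> {Suc i..<n}. \<forall>k. 0 < k \<and> k \<le> A $$ (i, j) \<longrightarrow> k \<in> (\<lambda>j. A $$ (i, j)) ` {Suc i..<n})
        \<longleftrightarrow> (\<forall>j \<in> {Suc i..<n}. \<forall>k. 0 < k \<and> k \<le> A $$ (i, j) \<longrightarrow> (\<exists>m < n. A $$ (i, m) = k))"
      by blast
    then have "(\<forall>j \<in> {Suc i..<n}. \<forall>k. 0 < k \<and> k \<le> A $$ (i, j) \<longrightarrow> k \<in> (\<lambda>j. A $$ (i, j)) ` {Suc i..<n})
        \<longleftrightarrow> (\<forall>j < n. \<forall>k. 0 < k \<and> k \<le> A $$ (i, j) \<longrightarrow> (\<exists>m < n. A $$ (i, m) = k))"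
      by (subst ball[symmetric]) (auto simp: zero)
    ultimately show ?thesis by (simp add: variation_map_iff)
  qed
  \<comment> \<open>The last row has an empty part right of the diagonal; this allows the row index
    to run over all of \<open>{1..n}\<close>, that is over \<open>i < n\<close> after the
    shift.\<close>
  have last: "variation (map (entry A n) [n + 1 ..< n + 1])"
    by (simp add: variation_def)
  have shift: "(\<forall>i. 1 \<le> i \<and> i < n \<longrightarrow> variation (map (entry A i) [i + 1 ..< n + 1])) \<longleftrightarrow>
      (\<forall>i < n. variation (map (entry A (Suc i)) [Suc i + 1 ..< n + 1]))" (is "?L \<longleftrightarrow> ?R")
  proof
    assume L: ?L
    show ?R
    proof (intro allI impI)
      fix i assume "i < n"
      then show "variation (map (entry A (Suc i)) [Suc i + 1 ..< n + 1])"
        using L[rule_format, of "Suc i"] last by (cases "Suc i = n") auto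
    qed
  next
    assume R: ?R
    show ?L
    proof (intro allI impI)
      fix i assume "1 \<le> i \<and> i < n"
      then show "variation (map (entry A i) [i + 1 ..< n + 1])"
        using R[rule_format, of "i - 1"] by (auto simp del: upt_Suc)
    qed
  qed
  have rows: "(\<forall>i < n. variation (map (entry A (Suc i)) [Suc i + 1 ..< n + 1])) \<longleftrightarrow>
      (\<forall>i < n. \<forall>j < n. 0 \<le> A $$ (i, j)) \<and>
      (\<forall>i < n. \<forall>j < n. \<forall>k < n. A $$ (i, j) = A $$ (i, k) \<and> 0 < A $$ (i, j) \<longrightarrow> j = k) \<and>
      (\<forall>i < n. \<forall>j < n. \<forall>k. 0 < k \<and> k \<le> A $$ (i, j) \<longrightarrow> (\<exists>m < n. A $$ (i, m) = k))"
    if "\<forall>i < n. \<forall>j \<le> i. A $$ (i, j) = 0"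
  proof -
    have "(\<forall>i < n. variation (map (entry A (Suc i)) [Suc i + 1 ..< n + 1])) \<longleftrightarrow>
        (\<forall>i < n. (\<forall>j < n. 0 \<le> A $$ (i, j)) \<and>
          (\<forall>j < n. \<forall>k < n. A $$ (i, j) = A $$ (i, k) \<and> 0 < A $$ (i, j) \<longrightarrow> j = k) \<and>
          (\<forall>j < n. \<forall>k. 0 < k \<and> k \<le> A $$ (i, j) \<longrightarrow> (\<exists>m < n. A $$ (i, m) = k)))"
      using that by (intro all_cong row) blast
    also have "\<dots> \<longleftrightarrow> (\<forall>i < n. \<forall>j < n. 0 \<le> A $$ (i, j)) \<and>
        (\<forall>i < n. \<forall>j < n. \<forall>k < n. A $$ (i, j) = A $$ (i, k) \<and> 0 < A $$ (i, j) \<longrightarrow> j = k) \<and>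
        (\<forall>i < n. \<forall>j < n. \<forall>k. 0 < k \<and> k \<le> A $$ (i, j) \<longrightarrow> (\<exists>m < n. A $$ (i, m) = k))"
      by meson
    finally show ?thesis .
  qed
  show ?thesis
  proof (cases "\<forall>i < n. \<forall>j \<le> i. A $$ (i, j) = 0")
    case True
    show ?thesis unfolding variation_matrix_def tri shift rows[OF True] ..
  next
    case False
    then show ?thesis unfolding variation_matrix_def tri by (simp only: simp_thms)
  qed
qed

lemma variation_matrixD:
  assumes "variation_matrix n A"
  shows "A \<in> carrier_mat n n"
    and "i < n \<Longrightarrow> j \<le> i \<Longrightarrow> A $$ (i, j) = 0"
    and "i < n \<Longrightarrow> j < n \<Longrightarrow> 0 \<le> A $$ (i, j)"
    and "i < n \<Longrightarrow> j < n \<Longrightarrow> k < n \<Longrightarrow> A $$ (i, j) = A $$ (i, k) \<Longrightarrow> 0 < A $$ (i, j) \<Longrightarrow> j = k"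
    and "i < n \<Longrightarrow> j < n \<Longrightarrow> 0 < x \<Longrightarrow> x \<le> A $$ (i, j) \<Longrightarrow> \<exists>m < n. A $$ (i, m) = x"
  using assms unfolding variation_matrix_iff by blast+

text \<open>Comparison with \<open>Suc p\<close> avoids a case distinction: the default value 0 is
  too small, just as an empty column has no witness. \<open>Suc\<close> turns an index into a
  label.\<close>

lemma Suc_le_last_positive_row_iff:
  assumes "A \<in> carrier_mat n n"
  shows "Suc p \<le> last_positive_row A (Suc j) \<longleftrightarrow> (\<exists>q < n. p \<le> q \<and> 0 < A $$ (q, j))"
proof -
  have "{i \<in> {1..dim_row A}. entry A i (Suc j) > 0} = Suc ` {q. q < n \<and> 0 < A $$ (q, j)}" (is "?X = _")
  proof (rule Set.set_eqI)
    fix i show "i \<in> ?X \<longleftrightarrow> i \<in> Suc ` {q. q < n \<and> 0 < A $$ (q, j)}"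
      using assms by (cases i) (auto simp: entry_def)
  qed
  moreover have "(\<exists>i \<in> {1..dim_row A}. entry A i (Suc j) > 0) \<longleftrightarrow> ?X \<noteq> {}" by auto
  ultimately show ?thesis
    unfolding last_positive_row_def by (auto simp: Max_ge_iff)
qed

lemma last_positive_row_eq_Suc_iff:
  assumes "A \<in> carrier_mat n n"
  shows "last_positive_row A (Suc j) = Suc p \<longleftrightarrow>
    p < n \<and> 0 < A $$ (p, j) \<and> (\<forall>q < n. 0 < A $$ (q, j) \<longrightarrow> q \<le> p)"
proof -
  have "last_positive_row A (Suc j) = Suc p \<longleftrightarrow>
      Suc p \<le> last_positive_row A (Suc j) \<and> \<not> Suc (Suc p) \<le> last_positive_row A (Suc j)"
    by auto
  also have "\<dots> \<longleftrightarrow> (\<exists>q < n. p \<le> q \<and> 0 < A $$ (q, j)) \<and> (\<forall>q < n. 0 < A $$ (q, j) \<longrightarrow> q \<le> p)"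
    unfolding Suc_le_last_positive_row_iff[OF assms] by (auto simp: Suc_le_eq not_le[symmetric])
  also have "\<dots> \<longleftrightarrow> p < n \<and> 0 < A $$ (p, j) \<and> (\<forall>q < n. 0 < A $$ (q, j) \<longrightarrow> q \<le> p)"
    by (auto dest: le_antisym)
  finally show ?thesis .
qed

section \<open>Matrices encoding a graph\<close>

text \<open>Only the signs of the entries and comparisons of positive entries within a row are
  recorded. This suffices to translate the last two properties of a removal order, and it covers
  both the matrix of a graph and the graph of a matrix.\<close>

definition encodes :: "'v doag \<Rightarrow> 'v list \<Rightarrow> int mat \<Rightarrow> bool" where
  "encodes G l A \<longleftrightarrow> distinct l \<and> set l = verts G \<and> edges G \<subseteq> verts G \<times> verts G \<and>
     A \<in> carrier_mat (length l) (length l) \<and>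
     (\<forall>i < length l. \<forall>j < length l. (l ! i, l ! j) \<in> edges G \<longleftrightarrow> 0 < A $$ (i, j)) \<and>
     (\<forall>i < length l. \<forall>j < length l. \<forall>k < length l. 0 < A $$ (i, j) \<and> 0 < A $$ (i, k) \<longrightarrow>
        ((l ! i, l ! j), (l ! i, l ! k)) \<in> out_order G (l ! i) \<longleftrightarrow> A $$ (i, j) < A $$ (i, k))"

lemma encodes_edgeE:
  assumes "encodes G l A" "(u, v) \<in> edges G"
  obtains i j where "i < length l" "j < length l" "u = l ! i" "v = l ! j" "0 < A $$ (i, j)"
proof -
  have "u \<in> set l" "v \<in> set l" using assms by (auto simp: encodes_def)
  then obtain i j where "i < length l" "j < length l" "u = l ! i" "v = l ! j"
    by (metis in_set_conv_nth)
  moreover from this have "0 < A $$ (i, j)" using assms by (auto simp: encodes_def)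
  ultimately show thesis by (rule that)
qed

lemma last_parent_iff:
  assumes enc: "encodes G l A" and "p < length l" "j < length l"
  shows "last_parent (edges G) l (l ! p) (l ! j) \<longleftrightarrow> last_positive_row A (Suc j) = Suc p"
proof -
  have A: "A \<in> carrier_mat (length l) (length l)" and dist: "distinct l"
    and E: "\<And>i k. i < length l \<Longrightarrow> k < length l \<Longrightarrow> (l ! i, l ! k) \<in> edges G \<longleftrightarrow> 0 < A $$ (i, k)"
    using enc by (auto simp: encodes_def)
  have "(\<forall>q. (q, l ! j) \<in> edges G \<longrightarrow> q = l ! p \<or> precedes l q (l ! p)) \<longleftrightarrow>
      (\<forall>q < length l. 0 < A $$ (q, j) \<longrightarrow> q \<le> p)" (is "?L \<longleftrightarrow> ?R")
  proof
    assume L: ?L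
    show ?R
    proof (intro allI impI)
      fix q assume "q < length l" "0 < A $$ (q, j)"
      then show "q \<le> p"
        using L[rule_format, of "l ! q"] assms(2,3) dist E
        by (auto simp: precedes_nth_iff nth_eq_iff_index_eq)
    qed
  next
    assume R: ?R
    show ?L
    proof (intro allI impI)
      fix q assume "(q, l ! j) \<in> edges G"
      with enc obtain i k where "i < length l" "k < length l" "q = l ! i" "l ! j = l ! k" "0 < A $$ (i, k)"
        by (rule encodes_edgeE)
      then show "q = l ! p \<or> precedes l q (l ! p)"
        using R assms(2,3) dist by (auto simp: precedes_nth_iff nth_eq_iff_index_eq le_less)
    qed
  qed
  then show ?thesis
    using assms(2,3) by (simp add: last_parent_def last_positive_row_eq_Suc_iff[OF A] E)
qed

text \<open>Parents of \<open>l ! j\<close> are the positive rows of column \<open>j\<close>, and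
  precedence is comparison of indices; so a parent of \<open>v\<close> not before a given parent of
  \<open>u\<close> is a positive entry in the same row or further down.\<close>

lemma parents_mono_iff:
  assumes enc: "encodes G l A"
  shows "parents_mono G l \<longleftrightarrow> mono_on {1..length l} (last_positive_row A)"
proof -
  let ?n = "length l" and ?b = "last_positive_row A"
  have A: "A \<in> carrier_mat ?n ?n" and dist: "distinct l"
    and E: "\<And>i k. i < ?n \<Longrightarrow> k < ?n \<Longrightarrow> (l ! i, l ! k) \<in> edges G \<longleftrightarrow> 0 < A $$ (i, k)"
    using enc by (auto simp: encodes_def)
  note b = Suc_le_last_positive_row_iff[OF A]
  show ?thesis
  proof
    assume L: "parents_mono G l"
    show "mono_on {1..?n} ?b"
    proof (rule mono_onI)
      fix i' j' assume ij': "i' \<in> {1..?n}" "j' \<in> {1..?n}" "i' \<le> j'"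
      then obtain i j where ij: "i' = Suc i" "j' = Suc j" "i < ?n" "j < ?n" "i \<le> j"
        by (cases i'; cases j') auto
      show "?b i' \<le> ?b j'"
      proof (cases "?b i'")
        case (Suc p)
        then obtain q where q: "q < ?n" "p \<le> q" "0 < A $$ (q, i)" using b[of p i] ij by auto
        show ?thesis
        proof (cases "i = j")
          case False
          then have "precedes l (l ! i) (l ! j)" "(l ! q, l ! i) \<in> edges G"
            using ij q E dist by (auto simp: precedes_nth_iff)
          then obtain r where r: "(r, l ! j) \<in> edges G" "l ! q = r \<or> precedes l (l ! q) r"
            using L unfolding parents_mono_def by blast
          with enc obtain k m where "k < ?n" "m < ?n" "r = l ! k" "l ! j = l ! m" "0 < A $$ (k, m)"
            by (elim encodes_edgeE)
          with r q ij dist have "k < ?n" "p \<le> k" "0 < A $$ (k, j)"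
            by (auto simp: precedes_nth_iff nth_eq_iff_index_eq)
          then show ?thesis using b[of p j] Suc ij by auto
        qed (simp add: ij)
      qed simp
    qed
  next
    assume R: "mono_on {1..?n} ?b"
    show "parents_mono G l"
      unfolding parents_mono_def
    proof (intro allI impI, elim conjE)
      fix u v p assume "precedes l u v" "(p, u) \<in> edges G"
      then obtain i j k where ij: "i < j" "j < ?n" "u = l ! i" "v = l ! j" "k < ?n" "p = l ! k"
          "(l ! k, l ! i) \<in> edges G"
        using enc by (auto simp: precedes_def elim: encodes_edgeE)
      then have "0 < A $$ (k, i)" using E by auto
      then have "Suc k \<le> ?b (Suc i)" using b ij(5) by auto
      also have "\<dots> \<le> ?b (Suc j)" using R ij by (auto intro: mono_onD)
      finally obtain q where q: "q < ?n" "k \<le> q" "0 < A $$ (q, j)" using b by auto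
      show "\<exists>q. (q, v) \<in> edges G \<and> (p = q \<or> precedes l p q)"
        using q ij E dist by (intro exI[of _ "l ! q"]) (auto simp: precedes_nth_iff le_less)
    qed
  qed
qed

text \<open>Equal last parents are equal positive values of \<open>b\<close>. By monotonicity such
  columns form an interval, so the comparisons of neighbours chain up to all pairs.\<close>

lemma ties_ordered_iff:
  assumes enc: "encodes G l A" and mono: "mono_on {1..length l} (last_positive_row A)"
  shows "ties_ordered G l \<longleftrightarrow>
    (\<forall>j. 1 \<le> j \<and> j < length l \<and>
         last_positive_row A j = last_positive_row A (j + 1) \<and> last_positive_row A j \<ge> 1 \<longrightarrow>
         entry A (last_positive_row A j) j < entry A (last_positive_row A j) (j + 1))"
    (is "_ \<longleftrightarrow> ?R")
proof -
  let ?n = "length l" and ?b = "last_positive_row A"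
  have A: "A \<in> carrier_mat ?n ?n" and dist: "distinct l"
    and ord: "\<And>i j k. i < ?n \<Longrightarrow> j < ?n \<Longrightarrow> k < ?n \<Longrightarrow> 0 < A $$ (i, j) \<Longrightarrow> 0 < A $$ (i, k) \<Longrightarrow>
      ((l ! i, l ! j), (l ! i, l ! k)) \<in> out_order G (l ! i) \<longleftrightarrow> A $$ (i, j) < A $$ (i, k)"
    using enc by (auto simp: encodes_def)
  note b = last_positive_row_eq_Suc_iff[OF A]
  show ?thesis
  proof
    assume L: "ties_ordered G l"
    show ?R
    proof (intro allI impI, elim conjE)
      fix j' assume j': "1 \<le> j'" "j' < ?n" "?b j' = ?b (j' + 1)" "?b j' \<ge> 1"
      then obtain j p where j: "j' = Suc j" and p: "?b (Suc j) = Suc p" by (cases j'; cases "?b j'") auto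
      then have p': "?b (Suc (Suc j)) = Suc p" using j' by simp
      have pos: "p < ?n" "0 < A $$ (p, j)" "0 < A $$ (p, Suc j)" using b p p' by auto
      have "last_parent (edges G) l (l ! p) (l ! j)" "last_parent (edges G) l (l ! p) (l ! Suc j)"
        using last_parent_iff[OF enc pos(1)] p p' j j' by auto
      moreover have "precedes l (l ! j) (l ! Suc j)" using dist j j' by (simp add: precedes_nth_iff)
      ultimately have "((l ! p, l ! j), (l ! p, l ! Suc j)) \<in> out_order G (l ! p)"
        using L unfolding ties_ordered_def by blast
      then show "entry A (?b j') j' < entry A (?b j') (j' + 1)"
        using ord[of p j "Suc j"] pos j'(2) p p' by (simp add: j entry_def)
    qed
  next
    assume R: ?R
    have chain: "A $$ (p, i) < A $$ (p, j)"
      if "i < j" "j < ?n" "?b (Suc i) = Suc p" "?b (Suc j) = Suc p" for i j p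
      using that
    proof (induction j)
      case (Suc j)
      have "?b (Suc i) \<le> ?b (Suc j)" "?b (Suc j) \<le> ?b (Suc (Suc j))"
        using Suc.prems mono_onD[OF mono, of "Suc i" "Suc j"] mono_onD[OF mono, of "Suc j" "Suc (Suc j)"]
        by auto
      \<comment> \<open>The value at this column is squeezed between two equal values, so the
        induction hypothesis and the neighbour condition both apply.\<close>
      then have bj: "?b (Suc j) = Suc p" using Suc.prems by simp
      have "A $$ (p, j) < A $$ (p, Suc j)"
        using R[rule_format, of "Suc j"] Suc.prems bj by (simp add: entry_def)
      with Suc bj show ?case by (cases "i = j") auto
    qed simp
    show "ties_ordered G l"
      unfolding ties_ordered_def
    proof (intro allI impI, elim conjE)
      fix u v p assume uv: "precedes l u v"
        and p: "last_parent (edges G) l p u" "last_parent (edges G) l p v"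
      obtain i j where ij: "i < j" "j < ?n" "u = l ! i" "v = l ! j"
        using uv by (auto simp: precedes_def)
      have "(p, u) \<in> edges G" using p(1) by (simp add: last_parent_def)
      with enc obtain k where k: "k < ?n" "p = l ! k" by (elim encodes_edgeE)
      have bk: "?b (Suc i) = Suc k" "?b (Suc j) = Suc k"
        using last_parent_iff[OF enc k(1)] p ij k by auto
      then have "0 < A $$ (k, i)" "0 < A $$ (k, j)" using b by auto
      then show "((p, u), (p, v)) \<in> out_order G p"
        using ord[of k i j] chain[OF ij(1,2) bk] ij k by simp
    qed
  qed
qed

section \<open>The matrix of a graph\<close>

lemma out_position_eq_rank:
  "out_position G (u, v) = rank (out_edges G u) (out_order G u) (u, v)"
  by (simp add: out_position_def rank_def)

lemma out_position_bij:
  assumes "is_doag G" "u \<in> verts G"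
  shows "bij_betw (out_position G) (out_edges G u) {1..card (out_edges G u)}"
proof -
  have "strict_total_order_on (out_edges G u) (out_order G u)"
    using assms by (simp add: is_doag_def)
  from rank_bij[OF this finite_out_edges[OF assms(1)]] show ?thesis
    by (rule bij_betw_cong[THEN iffD1, rotated]) (auto simp: out_position_eq_rank out_edges_def)
qed

lemma labelled_transition_matrix_index:
  assumes "is_doag G" "removal_order G l" "i < length l" "j < length l"
  shows "labelled_transition_matrix G $$ (i, j) =
    (if (l ! i, l ! j) \<in> edges G then int (out_position G (l ! i, l ! j)) else 0)"
  using assms decomposition_labelling_iff[OF assms(1), of l] removal_order_length[OF assms(2)]
  by (simp add: labelled_transition_matrix_def Let_def)

lemma labelled_transition_matrix_carrier:
  "labelled_transition_matrix G \<in> carrier_mat (card (verts G)) (card (verts G))"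
  by (simp add: labelled_transition_matrix_def Let_def)

text \<open>Positions start at 1, so positive entries are exactly the edges, and
  \<open>rank_less_iff\<close> identifies comparison of positions with the order of the
  edges.\<close>

lemma encodes_labelled_transition_matrix:
  assumes G: "is_doag G" and l: "removal_order G l"
  shows "encodes G l (labelled_transition_matrix G)"
proof -
  let ?A = "labelled_transition_matrix G" and ?n = "length l"
  note index = labelled_transition_matrix_index[OF G l]
  have set: "set l = verts G" using removal_orderD(2)[OF l] .
  have "out_position G (u, v) > 0" if "(u, v) \<in> edges G" for u v
  proof -
    have "u \<in> verts G" "(u, v) \<in> out_edges G u" using that G by (auto simp: is_doag_def out_edges_def)
    then show ?thesis using bij_betwE[OF out_position_bij[OF G]] by force
  qed
  then have pos: "(l ! i, l ! j) \<in> edges G \<longleftrightarrow> 0 < ?A $$ (i, j)" if "i < ?n" "j < ?n" for i j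
    using that by (simp add: index)
  have "((l ! i, l ! j), (l ! i, l ! k)) \<in> out_order G (l ! i) \<longleftrightarrow> ?A $$ (i, j) < ?A $$ (i, k)"
    if ijk: "i < ?n" "j < ?n" "k < ?n" and "0 < ?A $$ (i, j)" "0 < ?A $$ (i, k)" for i j k
  proof -
    have E: "(l ! i, l ! j) \<in> edges G" "(l ! i, l ! k) \<in> edges G" using that pos by auto
    have "strict_total_order_on (out_edges G (l ! i)) (out_order G (l ! i))"
      using G nth_mem[OF ijk(1)] set by (simp add: is_doag_def)
    from rank_less_iff[OF this finite_out_edges[OF G], of "(l ! i, l ! j)" "(l ! i, l ! k)"] E
    show ?thesis using ijk by (simp add: index out_position_eq_rank out_edges_def)
  qed
  with pos show ?thesis
    using removal_orderD(1,2)[OF l] G labelled_transition_matrix_carrier[of G] removal_order_length[OF l]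
    by (simp add: encodes_def is_doag_def)
qed

text \<open>Edges go forward in \<open>l\<close>, which gives zeros on and below the diagonal.
  Within a row the positions run bijectively through \<open>{1..d}\<close>, with \<open>d\<close>
  the out-degree, so positive entries neither repeat nor leave gaps.\<close>

lemma variation_matrix_labelled_transition_matrix:
  assumes G: "is_doag G" and l: "removal_order G l"
  shows "variation_matrix (length l) (labelled_transition_matrix G)"
proof -
  let ?A = "labelled_transition_matrix G" and ?n = "length l"
  note index = labelled_transition_matrix_index[OF G l]
  note dist = removal_orderD(1)[OF l] and set = removal_orderD(2)[OF l] and topo = removal_orderD(3)[OF l]
  have "?A $$ (i, j) = 0" if "i < ?n" "j \<le> i" for i j
  proof -
    have "(l ! i, l ! j) \<notin> edges G" using topo[of "l ! i" "l ! j"] that dist by (auto simp: precedes_nth_iff)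
    then show ?thesis using that by (simp add: index)
  qed
  moreover have "0 \<le> ?A $$ (i, j)" if "i < ?n" "j < ?n" for i j
    using that by (simp add: index)
  moreover have "j = k"
    if ijk: "i < ?n" "j < ?n" "k < ?n" and eq: "?A $$ (i, j) = ?A $$ (i, k)" "0 < ?A $$ (i, j)" for i j k
  proof -
    have "(l ! i, l ! j) \<in> out_edges G (l ! i)" "(l ! i, l ! k) \<in> out_edges G (l ! i)"
      and "out_position G (l ! i, l ! j) = out_position G (l ! i, l ! k)"
      using ijk eq by (auto simp: index out_edges_def split: if_splits)
    moreover have "inj_on (out_position G) (out_edges G (l ! i))"
      using out_position_bij[OF G] nth_mem[OF ijk(1)] set bij_betw_imp_inj_on by blast
    ultimately have "(l ! i, l ! j) = (l ! i, l ! k)" by (simp add: inj_on_eq_iff)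
    then show ?thesis using dist ijk by (simp add: nth_eq_iff_index_eq)
  qed
  moreover have "\<exists>m < ?n. ?A $$ (i, m) = k"
    if ij: "i < ?n" "j < ?n" and k: "0 < k" "k \<le> ?A $$ (i, j)" for i j k
  proof -
    have v: "l ! i \<in> verts G" using nth_mem[OF ij(1)] set by simp
    note bij = out_position_bij[OF G v]
    have e: "(l ! i, l ! j) \<in> out_edges G (l ! i)" and "k \<le> int (out_position G (l ! i, l ! j))"
      using ij k by (auto simp: index out_edges_def split: if_splits)
    moreover have "out_position G (l ! i, l ! j) \<le> card (out_edges G (l ! i))"
      using bij_betwE[OF bij] e by auto
    \<comment> \<open>Now \<open>k\<close> lies between 1 and the out-degree, so it is the position
      of some out-edge; the target of that edge gives the column.\<close>
    ultimately have "nat k \<in> out_position G ` out_edges G (l ! i)"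
      unfolding bij_betw_imp_surj_on[OF bij] using k(1) by auto
    then obtain w where w: "(l ! i, w) \<in> edges G" "out_position G (l ! i, w) = nat k"
      by (auto simp: out_edges_def)
    then have "w \<in> set l" using G set by (auto simp: is_doag_def)
    then obtain m where m: "m < ?n" "w = l ! m" by (metis in_set_conv_nth)
    then have "?A $$ (i, m) = k" using w k(1) ij(1) by (simp add: index)
    then show ?thesis using m by blast
  qed
  ultimately show ?thesis
    using labelled_transition_matrix_carrier[of G] removal_order_length[OF l]
    by (simp add: variation_matrix_iff)
qed

section \<open>The graph of a matrix\<close>

text \<open>The vertices are taken from a given list, so that the graph lives on the prescribed
  type. In \<open>out_order\<close> positivity of the smaller entry implies that of the larger one.
  Sources are ordered as in \<open>l\<close>, as a removal order requires.\<close>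

definition doag_of_matrix :: "'v list \<Rightarrow> int mat \<Rightarrow> 'v doag" where
  "doag_of_matrix l A =
     (let E = {(l ! i, l ! j) | i j. i < length l \<and> j < length l \<and> 0 < A $$ (i, j)}
      in \<lparr> verts = set l,
           edges = E,
           out_order = (\<lambda>v. {((l ! i, l ! j), (l ! i, l ! k)) | i j k. l ! i = v \<and>
             i < length l \<and> j < length l \<and> k < length l \<and>
             0 < A $$ (i, j) \<and> A $$ (i, j) < A $$ (i, k)}),
           src_order = {(u, v). u \<in> sources (set l) E \<and> v \<in> sources (set l) E \<and> precedes l u v} \<rparr>)"

lemma doag_of_matrix_simps:
  "verts (doag_of_matrix l A) = set l"
  "edges (doag_of_matrix l A) = {(l ! i, l ! j) | i j. i < length l \<and> j < length l \<and> 0 < A $$ (i, j)}"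
  "out_order (doag_of_matrix l A) v = {((l ! i, l ! j), (l ! i, l ! k)) | i j k. l ! i = v \<and>
     i < length l \<and> j < length l \<and> k < length l \<and> 0 < A $$ (i, j) \<and> A $$ (i, j) < A $$ (i, k)}"
  "src_order (doag_of_matrix l A) =
     {(u, v). u \<in> sources (verts (doag_of_matrix l A)) (edges (doag_of_matrix l A)) \<and>
              v \<in> sources (verts (doag_of_matrix l A)) (edges (doag_of_matrix l A)) \<and> precedes l u v}"
  by (simp_all add: doag_of_matrix_def Let_def)

lemma edge_doag_of_matrix_iff:
  assumes "distinct l" "i < length l" "j < length l"
  shows "(l ! i, l ! j) \<in> edges (doag_of_matrix l A) \<longleftrightarrow> 0 < A $$ (i, j)"
proof
  assume "(l ! i, l ! j) \<in> edges (doag_of_matrix l A)"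
  then obtain i' j' where "l ! i = l ! i'" "l ! j = l ! j'" "i' < length l" "j' < length l" "0 < A $$ (i', j')"
    unfolding doag_of_matrix_simps(2) by blast
  with assms show "0 < A $$ (i, j)" by (simp add: nth_eq_iff_index_eq)
qed (use assms in \<open>auto simp: doag_of_matrix_simps(2)\<close>)

lemma out_order_doag_of_matrixE:
  assumes "(e, f) \<in> out_order (doag_of_matrix l A) v"
  obtains i j k where "v = l ! i" "e = (v, l ! j)" "f = (v, l ! k)"
    "i < length l" "j < length l" "k < length l" "0 < A $$ (i, j)" "A $$ (i, j) < A $$ (i, k)"
  using assms unfolding doag_of_matrix_simps(3) by blast

lemma out_order_doag_of_matrix_iff:
  assumes "distinct l" "i < length l" "j < length l" "k < length l"
  shows "((l ! i, l ! j), (l ! i, l ! k)) \<in> out_order (doag_of_matrix l A) (l ! i) \<longleftrightarrow>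
    0 < A $$ (i, j) \<and> A $$ (i, j) < A $$ (i, k)"
proof
  assume "((l ! i, l ! j), (l ! i, l ! k)) \<in> out_order (doag_of_matrix l A) (l ! i)"
  then show "0 < A $$ (i, j) \<and> A $$ (i, j) < A $$ (i, k)"
    by (rule out_order_doag_of_matrixE) (use assms in \<open>simp add: nth_eq_iff_index_eq\<close>)
qed (use assms in \<open>unfold doag_of_matrix_simps(3), blast\<close>)

lemma encodes_doag_of_matrix:
  assumes "distinct l" "A \<in> carrier_mat (length l) (length l)"
  shows "encodes (doag_of_matrix l A) l A"
proof -
  have "edges (doag_of_matrix l A) \<subseteq> set l \<times> set l" by (auto simp: doag_of_matrix_simps(2))
  then show ?thesis
    using assms
    by (simp add: encodes_def doag_of_matrix_simps(1) edge_doag_of_matrix_iff out_order_doag_of_matrix_iff)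
qed

section \<open>The graph of a variation matrix is a DOAG\<close>

lemma edge_doag_of_matrix_precedes:
  assumes "distinct l" "variation_matrix (length l) A" "(u, v) \<in> edges (doag_of_matrix l A)"
  shows "precedes l u v"
proof -
  obtain i j where ij: "i < length l" "j < length l" "u = l ! i" "v = l ! j" "0 < A $$ (i, j)"
    using assms(3) unfolding doag_of_matrix_simps(2) by blast
  then have "i < j" using variation_matrixD(2)[OF assms(2) ij(1), of j] by (cases "j \<le> i") auto
  then show ?thesis using ij assms(1) by (simp add: precedes_nth_iff)
qed

lemma out_edges_doag_of_matrix:
  assumes "distinct l" "i < length l"
  shows "out_edges (doag_of_matrix l A) (l ! i) = (\<lambda>j. (l ! i, l ! j)) ` {j. j < length l \<and> 0 < A $$ (i, j)}"
proof (rule Set.set_eqI)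
  fix e
  show "e \<in> out_edges (doag_of_matrix l A) (l ! i) \<longleftrightarrow>
      e \<in> (\<lambda>j. (l ! i, l ! j)) ` {j. j < length l \<and> 0 < A $$ (i, j)}"
  proof
    assume "e \<in> out_edges (doag_of_matrix l A) (l ! i)"
    then obtain i' j where "e = (l ! i', l ! j)" "l ! i' = l ! i" "i' < length l" "j < length l" "0 < A $$ (i', j)"
      by (auto simp: out_edges_def doag_of_matrix_simps(2))
    with assms show "e \<in> (\<lambda>j. (l ! i, l ! j)) ` {j. j < length l \<and> 0 < A $$ (i, j)}"
      by (simp add: nth_eq_iff_index_eq)
  next
    assume "e \<in> (\<lambda>j. (l ! i, l ! j)) ` {j. j < length l \<and> 0 < A $$ (i, j)}"
    with assms show "e \<in> out_edges (doag_of_matrix l A) (l ! i)"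
      by (auto simp: out_edges_def edge_doag_of_matrix_iff)
  qed
qed

text \<open>Edges are contained in the precedence relation of \<open>l\<close>, hence acyclic. The
  out-orders are total because positive entries of a row are distinct.\<close>

lemma is_doag_doag_of_matrix:
  assumes dist: "distinct l" and A: "variation_matrix (length l) A"
  shows "is_doag (doag_of_matrix l A)"
proof -
  let ?G = "doag_of_matrix l A"
  have "edges ?G \<subseteq> {(u, v). precedes l u v}"
    using edge_doag_of_matrix_precedes[OF assms] by blast
  then have "acyclic (edges ?G)" by (rule acyclic_subset[OF acyclic_precedes[OF dist]])
  moreover have "strict_total_order_on (out_edges ?G v) (out_order ?G v)" if v: "v \<in> set l" for v
  proof -
    obtain i where i: "i < length l" "v = l ! i" using v by (metis in_set_conv_nth)
    note out = out_edges_doag_of_matrix[OF dist i(1), of A, folded i(2)]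
    show ?thesis
    proof (rule strict_total_order_onI)
      fix e f assume ef: "e \<in> out_edges ?G v" "f \<in> out_edges ?G v" "e \<noteq> f"
      then obtain j k where jk: "e = (v, l ! j)" "f = (v, l ! k)" "j < length l" "k < length l"
          "0 < A $$ (i, j)" "0 < A $$ (i, k)" "j \<noteq> k"
        unfolding out by blast
      then have "A $$ (i, j) \<noteq> A $$ (i, k)" using variation_matrixD(4)[OF A i(1)] by blast
      then show "(e, f) \<in> out_order ?G v \<or> (f, e) \<in> out_order ?G v"
        using jk out_order_doag_of_matrix_iff[OF dist i(1)] i(2) by auto
    next
      fix e f assume "(e, f) \<in> out_order ?G v"
      then obtain i j k where "v = l ! i" "e = (v, l ! j)" "f = (v, l ! k)"
          "i < length l" "j < length l" "k < length l" "0 < A $$ (i, j)" "A $$ (i, j) < A $$ (i, k)"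
        by (rule out_order_doag_of_matrixE)
      then show "e \<in> out_edges ?G v \<and> f \<in> out_edges ?G v"
        by (simp add: out_edges_def edge_doag_of_matrix_iff[OF dist])
    next
      fix e show "(e, e) \<notin> out_order ?G v"
      proof
        assume "(e, e) \<in> out_order ?G v"
        then show False
          by (rule out_order_doag_of_matrixE) (use dist in \<open>simp add: nth_eq_iff_index_eq\<close>)
      qed
    next
      fix e f g assume "(e, f) \<in> out_order ?G v" "(f, g) \<in> out_order ?G v"
      then obtain i j k i' j' k' where 1: "v = l ! i" "e = (v, l ! j)" "f = (v, l ! k)"
          "i < length l" "j < length l" "k < length l" "0 < A $$ (i, j)" "A $$ (i, j) < A $$ (i, k)"
        and 2: "v = l ! i'" "f = (v, l ! j')" "g = (v, l ! k')"
          "i' < length l" "j' < length l" "k' < length l" "A $$ (i', j') < A $$ (i', k')"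
        by (elim out_order_doag_of_matrixE)
      then have "i' = i" "j' = k" using dist by (simp_all add: nth_eq_iff_index_eq)
      then show "(e, g) \<in> out_order ?G v"
        using 1 2 out_order_doag_of_matrix_iff[OF dist 1(4,5) 2(6), of A] by simp
    qed
  qed
  moreover have "strict_total_order_on (sources (verts ?G) (edges ?G)) (src_order ?G)"
    unfolding doag_of_matrix_simps(4)
  proof (rule strict_total_order_onI)
    let ?S = "sources (verts ?G) (edges ?G)"
    let ?r = "{(u, v). u \<in> ?S \<and> v \<in> ?S \<and> precedes l u v}"
    show "(x, x) \<notin> ?r" for x using precedes_antisym[OF dist, of x x] by blast
    show "(x, z) \<in> ?r" if "(x, y) \<in> ?r" "(y, z) \<in> ?r" for x y z
      using that precedes_trans[OF dist, of x y z] by blast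
    show "(x, y) \<in> ?r \<or> (y, x) \<in> ?r" if "x \<in> ?S" "y \<in> ?S" "x \<noteq> y" for x y
    proof -
      have "x \<in> set l" "y \<in> set l" using that by (simp_all add: sources_def doag_of_matrix_simps(1))
      then show ?thesis using that precedes_linear[of x l y] by blast
    qed
  qed blast
  moreover have "edges ?G \<subseteq> set l \<times> set l" by (auto simp: doag_of_matrix_simps(2))
  ultimately show ?thesis by (simp add: is_doag_def doag_of_matrix_simps(1))
qed

text \<open>The position counts the positive entries of row \<open>i\<close> that are at most
  \<open>A $$ (i, j)\<close>. These are distinct and without gaps, so they are exactly the numbers
  from 1 to \<open>A $$ (i, j)\<close>.\<close>

lemma out_position_doag_of_matrix:
  assumes dist: "distinct l" and A: "variation_matrix (length l) A"
    and ij: "i < length l" "j < length l" and pos: "0 < A $$ (i, j)"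
  shows "int (out_position (doag_of_matrix l A) (l ! i, l ! j)) = A $$ (i, j)"
proof -
  let ?G = "doag_of_matrix l A" and ?n = "length l"
  let ?K = "{k. k < ?n \<and> 0 < A $$ (i, k) \<and> A $$ (i, k) \<le> A $$ (i, j)}"
  have inj: "inj_on (\<lambda>k. A $$ (i, k)) ?K"
    by (rule inj_onI) (use variation_matrixD(4)[OF A ij(1)] in blast)
  have mem: "(l ! i, l ! k) = (l ! i, l ! j) \<or> ((l ! i, l ! k), (l ! i, l ! j)) \<in> out_order ?G (l ! i) \<longleftrightarrow>
      A $$ (i, k) \<le> A $$ (i, j)" if k: "k < ?n" "0 < A $$ (i, k)" for k
  proof -
    \<comment> \<open>Equal positive entries sit in the same column, so the alternative of equal or
      smaller edges merges into one comparison of entries.\<close>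
    have "k = j \<longleftrightarrow> A $$ (i, k) = A $$ (i, j)" using variation_matrixD(4)[OF A ij(1) k(1) ij(2)] k(2) by blast
    then show ?thesis
      using k ij dist by (auto simp: out_order_doag_of_matrix_iff nth_eq_iff_index_eq)
  qed
  have "{f \<in> out_edges ?G (l ! i). f = (l ! i, l ! j) \<or> (f, (l ! i, l ! j)) \<in> out_order ?G (l ! i)}
      = (\<lambda>k. (l ! i, l ! k)) ` ?K"
    unfolding out_edges_doag_of_matrix[OF dist ij(1)] using mem by blast
  then have "out_position ?G (l ! i, l ! j) = card ((\<lambda>k. (l ! i, l ! k)) ` ?K)"
    by (simp add: out_position_def)
  also have "\<dots> = card ?K"
    using dist by (intro card_image inj_onI) (simp add: nth_eq_iff_index_eq)
  also have "\<dots> = card ((\<lambda>k. A $$ (i, k)) ` ?K)" using inj by (simp add: card_image)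
  also have "(\<lambda>k. A $$ (i, k)) ` ?K = {1..A $$ (i, j)}"
  proof (intro equalityI subsetI)
    fix x assume "x \<in> {1..A $$ (i, j)}"
    then have x: "0 < x" "x \<le> A $$ (i, j)" by auto
    then obtain m where "m < ?n" "A $$ (i, m) = x"
      using variation_matrixD(5)[OF A ij] by blast
    with x show "x \<in> (\<lambda>k. A $$ (i, k)) ` ?K" by blast
  qed auto
  finally show ?thesis using pos by simp
qed

text \<open>Since \<open>l\<close> is a removal order, it is the decomposition labelling. Entries at
  edges are then positions, and by nonnegativity all others are 0.\<close>

lemma labelled_transition_matrix_doag_of_matrix:
  assumes dist: "distinct l" and A: "variation_matrix (length l) A"
    and l: "removal_order (doag_of_matrix l A) l"
  shows "labelled_transition_matrix (doag_of_matrix l A) = A"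
proof -
  let ?G = "doag_of_matrix l A"
  have carrier: "A \<in> carrier_mat (length l) (length l)" using A by (simp add: variation_matrix_def)
  show ?thesis
  proof (rule eq_matI)
    fix i j assume "i < dim_row A" "j < dim_col A"
    then have ij: "i < length l" "j < length l" using carrier by auto
    have "(l ! i, l ! j) \<in> edges ?G \<longleftrightarrow> 0 < A $$ (i, j)"
      using encodes_doag_of_matrix[OF dist carrier] ij by (simp add: encodes_def)
    moreover have "0 \<le> A $$ (i, j)" using A ij by (simp add: variation_matrix_iff)
    ultimately show "labelled_transition_matrix ?G $$ (i, j) = A $$ (i, j)"
      using labelled_transition_matrix_index[OF is_doag_doag_of_matrix[OF dist A] l ij]
        out_position_doag_of_matrix[OF dist A ij] by auto
  qed (use carrier labelled_transition_matrix_carrier[of ?G] removal_order_length[OF l] in auto)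
qed

text \<open>Strict upper triangularity makes edges go forward, and the source order agrees with
  \<open>l\<close> by construction.\<close>

lemma removal_order_doag_of_matrix:
  assumes "distinct l" "variation_matrix (length l) A"
    and "parents_mono (doag_of_matrix l A) l" "ties_ordered (doag_of_matrix l A) l"
  shows "removal_order (doag_of_matrix l A) l"
  unfolding removal_order_def
  using assms edge_doag_of_matrix_precedes[OF assms(1,2)]
  by (simp add: doag_of_matrix_simps(1,4))

theorem theorem4p4:
  shows "(\<forall>G :: 'v doag. is_doag G \<longrightarrow>
            variation_matrix (card (verts G)) (labelled_transition_matrix G)) \<and>
         (\<forall>n A. variation_matrix n A \<longrightarrow> (\<exists>V :: 'v set. finite V \<and> card V = n) \<longrightarrow>
            ((\<exists>G :: 'v doag. is_doag G \<and> labelled_transition_matrix G = A) \<longleftrightarrow>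
               mono_on {1..n} (last_positive_row A) \<and>
               (\<forall>j. 1 \<le> j \<and> j < n \<and>
                    last_positive_row A j = last_positive_row A (j + 1) \<and>
                    last_positive_row A j \<ge> 1 \<longrightarrow>
                    entry A (last_positive_row A j) j <
                    entry A (last_positive_row A j) (j + 1))))"
proof (intro conjI allI impI)
  fix G :: "'v doag" assume G: "is_doag G"
  then have "removal_order G (decomposition_labelling G)"
    using decomposition_labelling_iff by blast
  then show "variation_matrix (card (verts G)) (labelled_transition_matrix G)"
    using variation_matrix_labelled_transition_matrix[OF G] removal_order_length by metis
next
  fix n A
  assume A: "variation_matrix n A" and "\<exists>V :: 'v set. finite V \<and> card V = n"
  \<comment> \<open>Any enumeration of an \<open>n\<close>-element set of type \<open>'v\<close> can
    serve as the vertex list of the graph to be built.\<close>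
  then obtain l :: "'v list" where l: "distinct l" "length l = n"
    by (metis finite_distinct_list distinct_card)
  let ?C = "mono_on {1..n} (last_positive_row A) \<and>
    (\<forall>j. 1 \<le> j \<and> j < n \<and> last_positive_row A j = last_positive_row A (j + 1) \<and>
       last_positive_row A j \<ge> 1 \<longrightarrow>
       entry A (last_positive_row A j) j < entry A (last_positive_row A j) (j + 1))"
  \<comment> \<open>The translation of ties presupposes monotonicity, so the two conditions are
    translated as a conjunction.\<close>
  have conditions: "?C \<longleftrightarrow> parents_mono G l \<and> ties_ordered G l"
    if "encodes G l A" "length l = n" for G :: "'v doag" and l
    using parents_mono_iff[OF that(1)] ties_ordered_iff[OF that(1)] that(2) by blast
  show "(\<exists>G :: 'v doag. is_doag G \<and> labelled_transition_matrix G = A) \<longleftrightarrow> ?C"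
  proof
    assume "\<exists>G :: 'v doag. is_doag G \<and> labelled_transition_matrix G = A"
    then obtain G :: "'v doag" where G: "is_doag G" "labelled_transition_matrix G = A" by blast
    define m where "m = decomposition_labelling G"
    have m: "removal_order G m" using decomposition_labelling_iff[OF G(1)] m_def by blast
    have enc: "encodes G m A" using encodes_labelled_transition_matrix[OF G(1) m] G(2) by simp
    \<comment> \<open>Both numbers are the dimension of \<open>A\<close>, so the graph has
      \<open>n\<close> vertices.\<close>
    then have "length m = n" using A by (auto simp: encodes_def variation_matrix_def)
    then show ?C using conditions[OF enc] m by (simp add: removal_order_def)
  next
    assume ?C
    let ?G = "doag_of_matrix l A"
    have A': "variation_matrix (length l) A" using A l by simp
    have "encodes ?G l A"
      using encodes_doag_of_matrix[OF l(1)] A' by (simp add: variation_matrix_def)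
    with \<open>?C\<close> have "parents_mono ?G l" "ties_ordered ?G l" using conditions l by auto
    then have "removal_order ?G l" by (rule removal_order_doag_of_matrix[OF l(1) A'])
    then show "\<exists>G :: 'v doag. is_doag G \<and> labelled_transition_matrix G = A"
      using is_doag_doag_of_matrix[OF l(1) A'] labelled_transition_matrix_doag_of_matrix[OF l(1) A'] by blast
  qed
qed

end
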